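(* Let $(P,\leq)$ be a poset and $a,b\in P$ with $a\neq b$. Define $f_{ab}\colon P\to P$ by $f_{ab}(a)=b$ and $f_{ab}(x)=x$ for $x\neq a$. Then $f_{ab}$ is strictly upper cone preserving if and only if $|L(a)|\leq2$ and $U^*(a)=U(b)$.
   Context: For $A\subseteq P$, $U(A)=\{x\in P\mid a\leq x\text{ for all }a\in A\}$ and $L(A)=\{x\in P\mid x\leq a\text{ for all }a\in A\}$; write $U(x,y)=U(\{x,y\})$, $U(x)=U(\{x\})$, $L(x)=L(\{x\})$, and $U^*(x)=U(x)\setminus\{x\}$. A mapping $f\colon P\to P$ is strictly upper cone preserving if $f(U(x,y))=U(f(x),f(y))$ for all $x,y\in P$ with $x\neq y$. *)

theory Defs
  imports Main
begin

definition upper_cone :: "'a::order set \<Rightarrow> 'a set" where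
  "upper_cone A = {x. \<forall>a\<in>A. a \<le> x}"

definition lower_cone :: "'a::order set \<Rightarrow> 'a set" where
  "lower_cone A = {x. \<forall>a\<in>A. x \<le> a}"

definition strict_upper_cone :: "'a::order \<Rightarrow> 'a set" where
  "strict_upper_cone x = upper_cone {x} - {x}"

definition strictly_upper_cone_preserving :: "('a::order \<Rightarrow> 'a) \<Rightarrow> bool" where
  "strictly_upper_cone_preserving f \<longleftrightarrow>
     (\<forall>x y. x \<noteq> y \<longrightarrow> f ` upper_cone {x, y} = upper_cone {f x, f y})"

definition f_map :: "'a \<Rightarrow> 'a \<Rightarrow> 'a \<Rightarrow> 'a" where
  "f_map a b x = (if x = a then b else x)"

end

theory Submission
  imports Defs
begin

text \<open>
  The value \<open>a\<close> is not attained by \<open>f_map a b\<close>, so no cone \<open>U(f x, f y)\<close> may contain it; this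
  excludes two distinct elements strictly below \<open>a\<close>. The pairs \<open>(a, b)\<close> and \<open>(a, x)\<close> with \<open>a < x\<close>
  yield \<open>a < b\<close> and \<open>b \<le> x\<close>. Conversely, the only cones \<open>U(x, y)\<close> with \<open>x \<noteq> y\<close> that contain \<open>a\<close>
  are \<open>U(a, y) = U(a)\<close> with \<open>y < a\<close>, and moving \<open>a\<close> to \<open>b\<close> turns \<open>U(a)\<close> into \<open>U(b)\<close>.
\<close>

lemma mem_upper_cone_insert [simp]: "x \<in> upper_cone (insert c A) \<longleftrightarrow> c \<le> x \<and> x \<in> upper_cone A"
  by (auto simp: upper_cone_def)

lemma upper_cone_empty [simp]: "upper_cone {} = UNIV"
  by (simp add: upper_cone_def)

lemma mem_strict_upper_cone [simp]: "x \<in> strict_upper_cone a \<longleftrightarrow> a < x"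
  by (auto simp: strict_upper_cone_def less_le)

lemma f_map_eq [simp]: "f_map a b a = b"
  and f_map_neq [simp]: "x \<noteq> a \<Longrightarrow> f_map a b x = x"
  by (simp_all add: f_map_def)

lemma image_f_map: "f_map a b ` A = (if a \<in> A then insert b (A - {a}) else A)"
  by (auto simp: f_map_def image_iff)

text \<open>\<open>L(a)\<close> is \<open>a\<close> together with the elements strictly below it, so
  the bound 2 leaves room for at most one of these. Finiteness is stated separately because
  \<open>card\<close> is 0 on infinite sets.\<close>

lemma card_lower_cone_le_2_iff:
  fixes a :: "'a::order"
  shows "finite (lower_cone {a}) \<and> card (lower_cone {a}) \<le> 2 \<longleftrightarrow>
    (\<forall>c d. c < a \<longrightarrow> d < a \<longrightarrow> c = d)"
proof -
  have L: "lower_cone {a} = insert a {..<a}"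
    by (auto simp: lower_cone_def)
  have "finite (lower_cone {a}) \<and> card (lower_cone {a}) \<le> 2 \<longleftrightarrow> finite {..<a} \<and> card {..<a} \<le> 1"
    by (auto simp: L)
  also have "\<dots> \<longleftrightarrow> (\<forall>c d. c < a \<longrightarrow> d < a \<longrightarrow> c = d)"
  proof
    assume "finite {..<a} \<and> card {..<a} \<le> 1"
    then show "\<forall>c d. c < a \<longrightarrow> d < a \<longrightarrow> c = d"
      by (auto simp: card_le_Suc0_iff_eq)
  next
    assume unique: "\<forall>c d. c < a \<longrightarrow> d < a \<longrightarrow> c = d"
    \<comment> \<open>If nothing lies below \<open>a\<close>, the choice is arbitrary and the
      inclusion is trivial.\<close>
    then have "{..<a} \<subseteq> {SOME c. c < a}"
      by (metis (mono_tags, lifting) lessThan_iff singletonI someI_ex subsetI)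
    then have "finite {..<a}"
      by (rule finite_subset) simp
    with unique show "finite {..<a} \<and> card {..<a} \<le> 1"
      by (auto simp: card_le_Suc0_iff_eq)
  qed
  finally show ?thesis .
qed

theorem theorem3p4:
  fixes a b :: "'a::order"
  assumes "a \<noteq> b"
  shows "strictly_upper_cone_preserving (f_map a b) \<longleftrightarrow>
    (finite (lower_cone {a}) \<and> card (lower_cone {a}) \<le> 2) \<and>
    strict_upper_cone a = upper_cone {b}"
  unfolding card_lower_cone_le_2_iff
proof (intro iffI conjI)
  assume "strictly_upper_cone_preserving (f_map a b)"
  then have pres: "f_map a b ` upper_cone {x, y} = upper_cone {f_map a b x, f_map a b y}"
    if "x \<noteq> y" for x y
    using that by (simp add: strictly_upper_cone_preserving_def)
  have a_notin: "a \<notin> upper_cone {f_map a b x, f_map a b y}" if "x \<noteq> y" for x y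
    unfolding pres[OF that, symmetric] using assms by (simp add: image_f_map)
  show "\<forall>c d. c < a \<longrightarrow> d < a \<longrightarrow> c = d"
  proof (intro allI impI)
    fix c d assume "c < a" "d < a"
    then show "c = d"
      \<comment> \<open>Both \<open>c\<close> and \<open>d\<close> are fixed by the map, so if they
        were distinct, \<open>a\<close> would lie in the forbidden cone
        \<open>U(c, d)\<close>.\<close>
      using a_notin[of c d] by (auto simp: less_le)
  qed
  have "\<not> b \<le> a"
    using a_notin[OF assms] assms by simp
  moreover have "b \<in> f_map a b ` upper_cone {a, b}"
    using pres[OF assms] assms by simp
  \<comment> \<open>Only \<open>a\<close> and \<open>b\<close> are mapped to \<open>b\<close>. As
    \<open>a\<close> is not in \<open>U(a, b)\<close>, the preimage found there must be
    \<open>b\<close> itself.\<close>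
  ultimately have "a < b"
    using assms by (auto simp: image_f_map split: if_splits)
  have "b \<le> x" if "a < x" for x
  proof -
    \<comment> \<open>\<open>x\<close> lies in \<open>U(a, x)\<close> and is fixed, so preservation
      puts it into \<open>U(b, x)\<close>.\<close>
    have "x \<in> f_map a b ` upper_cone {a, x}"
      using that by (auto simp: image_f_map)
    with pres[of a x] that show ?thesis
      by auto
  qed
  with \<open>a < b\<close> show "strict_upper_cone a = upper_cone {b}"
    by (auto intro: less_le_trans)
next
  assume R: "(\<forall>c d. c < a \<longrightarrow> d < a \<longrightarrow> c = d) \<and> strict_upper_cone a = upper_cone {b}"
  then have unique: "c = d" if "c < a" "d < a" for c d
    using that by blast
  have above: "a < x \<longleftrightarrow> b \<le> x" for x
    using R by (simp add: set_eq_iff)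
  have pair_a: "f_map a b ` upper_cone {a, y} = upper_cone {b, y}" if "y \<noteq> a" for y
  proof (cases "y < a")
    case True
    have "a \<in> upper_cone {a, y}"
      using True by simp
    \<comment> \<open>Here \<open>y < a < b\<close>, so replacing \<open>a\<close> by
      \<open>b\<close> stays inside \<open>U(b, y)\<close>.\<close>
    moreover have "x = b \<or> (a \<le> x \<and> y \<le> x) \<and> x \<noteq> a \<longleftrightarrow> b \<le> x \<and> y \<le> x" for x
      using above[of x] above[of b] True by (auto simp: less_le)
    ultimately show ?thesis
      by (simp add: image_f_map set_eq_iff)
  next
    case False
    with that have "a \<notin> upper_cone {a, y}"
      by (simp add: less_le)
    \<comment> \<open>Since \<open>y \<le> a\<close> fails, \<open>x = a\<close> is excluded on the
      left, and \<open>a < x\<close> means \<open>b \<le> x\<close>.\<close>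
    moreover have "a \<le> x \<and> y \<le> x \<longleftrightarrow> b \<le> x \<and> y \<le> x" for x
      using above[of x] False that by (auto simp: less_le)
    ultimately show ?thesis
      by (simp add: image_f_map set_eq_iff)
  qed
  show "strictly_upper_cone_preserving (f_map a b)"
    unfolding strictly_upper_cone_preserving_def
  proof (intro allI impI)
    fix x y :: 'a
    assume "x \<noteq> y"
    consider "x = a" | "y = a" | "x \<noteq> a" "y \<noteq> a"
      by blast
    then show "f_map a b ` upper_cone {x, y} = upper_cone {f_map a b x, f_map a b y}"
    proof cases
      case 1
      with pair_a \<open>x \<noteq> y\<close> show ?thesis by simp
    next
      case 2
      with pair_a[of x] \<open>x \<noteq> y\<close> show ?thesis by (simp add: insert_commute)
    next
      case 3
      \<comment> \<open>Distinct \<open>x\<close> and \<open>y\<close> cannot both lie below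
        \<open>a\<close>, so the cone misses \<open>a\<close> and is fixed pointwise.\<close>
      with unique[of x y] \<open>x \<noteq> y\<close> show ?thesis
        by (auto simp: image_f_map less_le)
    qed
  qed
qed

end
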